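(* Let $(\delta_1,Q_1,\{v_1^{\delta_1},\ldots,v_n^{\delta_1}\})$ and $(\delta_2,Q_2,\{v_1^{\delta_2},\ldots,v_m^{\delta_2}\})$ be cone fundamental triples in $\mathbb{R}^n$ and $\mathbb{R}^m$, let $\delta_1\to\delta_2$ be a cone morphism defined by a linear map $f\colon\mathbb{R}^n\to\mathbb{R}^m$, and let $\Phi_{\delta_2\delta_1}\colon X_{\delta_1}\to X_{\delta_2}$ be the induced affine toric morphism. Then $\Phi_{\delta_2\delta_1}$ is equivariant with respect to the quasitorus actions, namely $$\Phi_{\delta_2\delta_1}\big([\exp_{\delta_1}(v)]\cdot[z_1:\cdots:z_n]\big)=[\exp_{\delta_2}(f(v))]\cdot\Phi_{\delta_2\delta_1}([z_1:\cdots:z_n])$$ for all $v\in\mathbb{C}^n$ and all $[z_1:\cdots:z_n]\in X_{\delta_1}$, where $f$ is extended $\mathbb{C}$-linearly to $\mathbb{C}^n\to\mathbb{C}^m$.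
   Context: A quasilattice $Q$ in $\mathbb{R}^n$ is the $\mathbb{Z}$-span of a set of vectors that spans $\mathbb{R}^n$. An $r$-dimensional simplicial cone $\delta\subset\mathbb{R}^n$ ($0\le r\le n$) is the set of non-negative real combinations of $r$ linearly independent vectors (its ray generators); $\{0\}$ is the case $r=0$. A cone fundamental triple $(\delta,Q,\{v_1^\delta,\ldots,v_n^\delta\})$ in $\mathbb{R}^n$ consists of a quasilattice $Q\subset\mathbb{R}^n$, vectors $v_1^\delta,\ldots,v_n^\delta\in Q$ forming a basis of $\mathbb{R}^n$, and a simplicial cone $\delta$ whose ray generators are the $v_i^\delta$ with $i$ in a subset $I_\delta\subseteq\{1,\ldots,n\}$. Let $\alpha_1^\delta,\ldots,\alpha_n^\delta$ be the dual basis of $(\mathbb{R}^n)^*$, let $L_\delta=\bigoplus_i\mathbb{Z}v_i^\delta\subset Q$, and let $\Gamma_\delta=Q/L_\delta$. Put $U_\delta=\{z\in\mathbb{C}^n\mid z_i\neq0\text{ for all }i\notin I_\delta\}$. The group $\Gamma_\delta$ acts on $U_\delta$ by $[v]\cdot(z_1,\ldots,z_n)=(e^{2\pi i\alpha_1^\delta(v)}z_1,\ldots,e^{2\pi i\alpha_n^\delta(v)}z_n)$, $v\in Q$. The affine toric quasifold of the triple is $X_\delta=U_\delta/\Gamma_\delta$; the class of $(z_1,\ldots,z_n)$ is written $[z_1:\cdots:z_n]$. A cone morphism $\delta_1\to\delta_2$ between cones with quasilattices $Q_1\subset\mathbb{R}^n$, $Q_2\subset\mathbb{R}^m$ is a linear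 map $f\colon\mathbb{R}^n\to\mathbb{R}^m$ with $f(Q_1)\subset Q_2$ and $f(\delta_1)\subset\delta_2$. The affine toric morphism induced by it is the (well-defined) map $$\Phi_{\delta_2\delta_1}\colon X_{\delta_1}\to X_{\delta_2},\quad [z_1:\cdots:z_n]\mapsto\left[\prod_{h=1}^n z_h^{\alpha_1^{\delta_2}(f(v_h^{\delta_1}))}:\cdots:\prod_{h=1}^n z_h^{\alpha_m^{\delta_2}(f(v_h^{\delta_1}))}\right].$$ Convention on real powers: for each nonzero $z_h$ choose $x_h\in\mathbb{C}$ with $z_h=e^{2\pi i x_h}$ (the same choice for all monomials) and set $z_h^a=e^{2\pi i a x_h}$ for $a\in\mathbb{R}$; if $z_h=0$, then $z_h^a=0$ for $a>0$ and $z_h^0=1$ (negative exponents do not occur for $z_h=0$). The resulting class does not depend on the choices. Quasitorus action: extend each $\alpha_i^\delta$ $\mathbb{C}$-linearly to $\mathbb{C}^n$ and put $\exp_\delta(u)=(e^{2\pi i\alpha_1^\delta(u)},\ldots,e^{2\pi i\alpha_n^\delta(u)})\in(\mathbb{C}^* )^n$ for $u\in\mathbb{C}^n$. Identify $\Gamma_\delta$ with the subgroup $\exp_\delta(Q)\subset(\mathbb{C}^* )^n$. The quasitorus $X_{\{0\}}^\delta=(\mathbb{C}^* )^n/\Gamma_\delta$ acts on $X_\delta$ by $[\exp_\delta(u)]\cdot[z_1:\cdots:z_n]=[e^{2\pi i\alpha_1^\delta(u)}z_1:\cdots:e^{2\pi i\alpha_n^\delta(u)}z_n]$. *)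

theory Defs
  imports "HOL-Analysis.Analysis" "HOL-Algebra.Coset"
begin

global_interpretation int_module: module "\<lambda>(k::int) (x::'a::real_vector). of_int k *\<^sub>R x"
  defines int_span = int_module.span
  by unfold_locales (auto simp: algebra_simps)

definition quasilattice :: "(real ^ 'n) set \<Rightarrow> bool" where
  "quasilattice Q \<longleftrightarrow> (\<exists>S. span S = UNIV \<and> Q = int_span S)"

text \<open>\<open>B\<close> is the set of ray generators; \<open>independent B\<close> already makes it finite.\<close>

definition simplicial_cone :: "(real ^ 'n) set \<Rightarrow> (real ^ 'n) set \<Rightarrow> bool" where
  "simplicial_cone B \<delta> \<longleftrightarrow>
     independent B \<and> \<delta> = {\<Sum>b\<in>B. c b *\<^sub>R b | c. \<forall>b\<in>B. 0 \<le> c b}"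

text \<open>The basis is indexed by \<open>'n\<close>, as are the coordinates of \<^typ>\<open>real ^ 'n\<close> and
  \<^typ>\<open>complex ^ 'n\<close>.\<close>

record ('n::finite) cone_triple =
  tcone :: "(real ^ 'n) set"
  qlat :: "(real ^ 'n) set"
  gen :: "'n \<Rightarrow> real ^ 'n"

definition cone_fundamental_triple :: "('n::finite) cone_triple \<Rightarrow> bool" where
  "cone_fundamental_triple T \<longleftrightarrow>
     quasilattice (qlat T) \<and>
     (\<forall>i. gen T i \<in> qlat T) \<and>
     inj (gen T) \<and> independent (range (gen T)) \<and> span (range (gen T)) = UNIV \<and>
     (\<exists>I. simplicial_cone (gen T ` I) (tcone T))"

text \<open>The subset $I_\delta$ is determined by the cone and the basis, see
  \<open>simplicial_cone_ray_index\<close> below.\<close>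

definition ray_index :: "('n::finite) cone_triple \<Rightarrow> 'n set" where
  "ray_index T = (THE I. simplicial_cone (gen T ` I) (tcone T))"

definition dual_basis :: "('n::finite) cone_triple \<Rightarrow> 'n \<Rightarrow> real ^ 'n \<Rightarrow> real" where
  "dual_basis T i = (THE \<alpha>. linear \<alpha> \<and> (\<forall>j. \<alpha> (gen T j) = (if i = j then 1 else 0)))"

definition Re_vec :: "complex ^ 'n \<Rightarrow> real ^ 'n" where
  "Re_vec u = (\<chi> i. Re (u $ i))"

definition Im_vec :: "complex ^ 'n \<Rightarrow> real ^ 'n" where
  "Im_vec u = (\<chi> i. Im (u $ i))"

definition complexify :: "(real ^ 'n \<Rightarrow> real ^ 'm) \<Rightarrow> complex ^ 'n \<Rightarrow> complex ^ 'm" where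
  "complexify f u = (\<chi> j. Complex (f (Re_vec u) $ j) (f (Im_vec u) $ j))"

definition complexify_form :: "(real ^ 'n \<Rightarrow> real) \<Rightarrow> complex ^ 'n \<Rightarrow> complex" where
  "complexify_form \<alpha> u = Complex (\<alpha> (Re_vec u)) (\<alpha> (Im_vec u))"

definition cone_domain :: "('n::finite) cone_triple \<Rightarrow> (complex ^ 'n) set" where
  "cone_domain T = {z. \<forall>i. i \<notin> ray_index T \<longrightarrow> z $ i \<noteq> 0}"

definition qlat_group :: "('n::finite) cone_triple \<Rightarrow> (real ^ 'n) monoid" where
  "qlat_group T = \<lparr>carrier = qlat T, monoid.mult = (+), one = 0\<rparr>"

definition sublattice :: "('n::finite) cone_triple \<Rightarrow> (real ^ 'n) set" where
  "sublattice T = int_span (range (gen T))"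

definition Gamma_group :: "('n::finite) cone_triple \<Rightarrow> (real ^ 'n) set monoid" where
  "Gamma_group T = qlat_group T Mod sublattice T"

text \<open>Here and below a map on classes is the common value on all representatives, extracted by
  \<^const>\<open>the_elem\<close>. Products of vectors of type \<^typ>\<open>complex ^ 'n\<close> are componentwise.\<close>

definition Gamma_act ::
  "('n::finite) cone_triple \<Rightarrow> (real ^ 'n) set \<Rightarrow> complex ^ 'n \<Rightarrow> complex ^ 'n" where
  "Gamma_act T g z =
     the_elem ((\<lambda>v. \<chi> i. exp (2 * of_real pi * \<i> * of_real (dual_basis T i v)) * z $ i) ` g)"

definition orbit_rel :: "('n::finite) cone_triple \<Rightarrow> (complex ^ 'n) rel" where
  "orbit_rel T =
     {(z, w). z \<in> cone_domain T \<and> (\<exists>g \<in> carrier (Gamma_group T). w = Gamma_act T g z)}"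

definition quasifold :: "('n::finite) cone_triple \<Rightarrow> (complex ^ 'n) set set" where
  "quasifold T = cone_domain T // orbit_rel T"

definition quasifold_class :: "('n::finite) cone_triple \<Rightarrow> complex ^ 'n \<Rightarrow> (complex ^ 'n) set" where
  "quasifold_class T z = orbit_rel T `` {z}"

definition cone_morphism ::
  "('n::finite) cone_triple \<Rightarrow> ('m::finite) cone_triple \<Rightarrow> (real ^ 'n \<Rightarrow> real ^ 'm) \<Rightarrow> bool" where
  "cone_morphism T1 T2 f \<longleftrightarrow>
     linear f \<and> f ` qlat T1 \<subseteq> qlat T2 \<and> f ` tcone T1 \<subseteq> tcone T2"

definition log_choice :: "complex ^ 'n \<Rightarrow> ('n \<Rightarrow> complex) \<Rightarrow> bool" where
  "log_choice z x \<longleftrightarrow> (\<forall>h. z $ h \<noteq> 0 \<longrightarrow> z $ h = exp (2 * of_real pi * \<i> * x h))"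

text \<open>The power $z^a$ computed with the chosen logarithm \<open>x\<close> of \<open>z\<close>, which is irrelevant if
  \<open>z = 0\<close>. The combination \<open>z = 0\<close>, \<open>a < 0\<close> does not occur in the morphisms below.\<close>

definition chosen_power :: "complex \<Rightarrow> complex \<Rightarrow> real \<Rightarrow> complex" where
  "chosen_power z x a =
     (if z \<noteq> 0 then exp (2 * of_real pi * \<i> * of_real a * x) else if a = 0 then 1 else 0)"

definition toric_monomials ::
  "('n::finite) cone_triple \<Rightarrow> ('m::finite) cone_triple \<Rightarrow> (real ^ 'n \<Rightarrow> real ^ 'm) \<Rightarrow>
   complex ^ 'n \<Rightarrow> ('n \<Rightarrow> complex) \<Rightarrow> complex ^ 'm" where
  "toric_monomials T1 T2 f z x =
     (\<chi> i. \<Prod>h\<in>UNIV. chosen_power (z $ h) (x h) (dual_basis T2 i (f (gen T1 h))))"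

definition affine_toric_morphism ::
  "('n::finite) cone_triple \<Rightarrow> ('m::finite) cone_triple \<Rightarrow> (real ^ 'n \<Rightarrow> real ^ 'm) \<Rightarrow>
   (complex ^ 'n) set \<Rightarrow> (complex ^ 'm) set" where
  "affine_toric_morphism T1 T2 f p =
     the_elem {quasifold_class T2 (toric_monomials T1 T2 f z x) | z x. z \<in> p \<and> log_choice z x}"

definition exp_map :: "('n::finite) cone_triple \<Rightarrow> complex ^ 'n \<Rightarrow> complex ^ 'n" where
  "exp_map T u = (\<chi> i. exp (2 * of_real pi * \<i> * complexify_form (dual_basis T i) u))"

definition complex_torus :: "(complex ^ 'n) monoid" where
  "complex_torus = \<lparr>carrier = {z. \<forall>i. z $ i \<noteq> 0}, monoid.mult = (*), one = 1\<rparr>"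

text \<open>The image of $\Gamma_\delta$ in the torus is $\exp_\delta(Q)$.\<close>

definition exp_qlat :: "('n::finite) cone_triple \<Rightarrow> (complex ^ 'n) set" where
  "exp_qlat T = (\<lambda>v. exp_map T (\<chi> i. of_real (v $ i))) ` qlat T"

definition quasitorus :: "('n::finite) cone_triple \<Rightarrow> (complex ^ 'n) set monoid" where
  "quasitorus T = complex_torus Mod exp_qlat T"

definition quasitorus_class :: "('n::finite) cone_triple \<Rightarrow> complex ^ 'n \<Rightarrow> (complex ^ 'n) set" where
  "quasitorus_class T t = exp_qlat T #>\<^bsub>complex_torus\<^esub> t"

definition quasitorus_act ::
  "('n::finite) cone_triple \<Rightarrow> (complex ^ 'n) set \<Rightarrow> (complex ^ 'n) set \<Rightarrow> (complex ^ 'n) set" where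
  "quasitorus_act T t p =
     the_elem {quasifold_class T (exp_map T u * z) | u z. exp_map T u \<in> t \<and> z \<in> p}"


text \<open>The lemmas below show that the ray index set, the dual basis and the maps on classes are
  well-defined, i.e. that they satisfy the formulas on representatives.\<close>

lemma int_span_closed:
  "0 \<in> int_span S" "x \<in> int_span S \<Longrightarrow> y \<in> int_span S \<Longrightarrow> x + y \<in> int_span S"
  "x \<in> int_span S \<Longrightarrow> - x \<in> int_span S"
  by (simp_all add: int_module.span_zero int_module.span_add int_module.span_neg)

lemma exp_two_pi_of_int: "exp (2 * complex_of_real pi * \<i> * of_int k) = 1"
  using exp_integer_2pi[OF Ints_of_int, of k] by (simp add: mult_ac)

context
  fixes T :: "('n::finite) cone_triple"
  assumes T: "cone_fundamental_triple T"
begin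

lemma gen_basis: "inj (gen T)" "independent (range (gen T))" "span (range (gen T)) = UNIV"
  using T by (auto simp: cone_fundamental_triple_def)

lemma linear_eq_on_gen:
  fixes f g :: "real ^ 'n \<Rightarrow> 'b::real_vector"
  assumes "linear f" "linear g" "\<And>j. f (gen T j) = g (gen T j)"
  shows "f = g"
proof
  fix x show "f x = g x"
    by (rule linear_eq_on_span[OF assms(1,2), of "range (gen T)"]) (use assms(3) gen_basis in auto)
qed

lemma dual_basis:
  "linear (dual_basis T i)" "dual_basis T i (gen T j) = (if i = j then 1 else 0)"
proof -
  obtain \<beta> where \<beta>: "linear \<beta>" "\<And>x. x \<in> range (gen T) \<Longrightarrow> \<beta> x = (if x = gen T i then 1 else 0::real)"
    using linear_independent_extend[OF gen_basis(2), of "\<lambda>x. if x = gen T i then 1 else 0"] by blast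
  have *: "\<exists>!\<alpha>. linear \<alpha> \<and> (\<forall>j. \<alpha> (gen T j) = (if i = j then 1 else 0::real))"
  proof (rule ex1I[of _ \<beta>])
    show "linear \<beta> \<and> (\<forall>j. \<beta> (gen T j) = (if i = j then 1 else 0))"
      using \<beta> gen_basis(1) by (auto simp: inj_eq)
    then show "\<And>\<alpha>. linear \<alpha> \<and> (\<forall>j. \<alpha> (gen T j) = (if i = j then 1 else 0)) \<Longrightarrow> \<alpha> = \<beta>"
      by (intro linear_eq_on_gen) auto
  qed
  from theI'[OF *] show "linear (dual_basis T i)" "dual_basis T i (gen T j) = (if i = j then 1 else 0)"
    unfolding dual_basis_def by auto
qed

lemma dual_basis_expand: "x = (\<Sum>h\<in>UNIV. dual_basis T h x *\<^sub>R gen T h)"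
proof -
  have "linear (\<lambda>x. \<Sum>h\<in>UNIV. dual_basis T h x *\<^sub>R gen T h)"
    by (simp add: linear_iff linear_add[OF dual_basis(1)] linear_cmul[OF dual_basis(1)]
        scaleR_add_left sum.distrib scaleR_sum_right)
  moreover have "(\<Sum>h\<in>UNIV. dual_basis T h (gen T j) *\<^sub>R gen T h) = gen T j" for j
  proof -
    have "(\<Sum>h\<in>UNIV. dual_basis T h (gen T j) *\<^sub>R gen T h) = (\<Sum>h\<in>UNIV. if h = j then gen T h else 0)"
      by (intro sum.cong) (auto simp: dual_basis(2))
    then show ?thesis by simp
  qed
  ultimately have "(\<lambda>x. x) = (\<lambda>x. \<Sum>h\<in>UNIV. dual_basis T h x *\<^sub>R gen T h)"
    by (intro linear_eq_on_gen) (auto simp: linear_iff)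
  then show ?thesis by metis
qed

lemma simplicial_cone_gen_iff:
  assumes "simplicial_cone (gen T ` I) \<delta>"
  shows "x \<in> \<delta> \<longleftrightarrow> (\<forall>i. 0 \<le> dual_basis T i x) \<and> (\<forall>i. i \<notin> I \<longrightarrow> dual_basis T i x = 0)"
proof
  have inj: "inj_on (gen T) I"
    using gen_basis(1) by (metis inj_on_subset top_greatest)
  have \<delta>: "\<delta> = {\<Sum>b\<in>gen T ` I. c b *\<^sub>R b | c. \<forall>b\<in>gen T ` I. 0 \<le> c b}"
    using assms by (simp add: simplicial_cone_def)
  {
    assume "x \<in> \<delta>"
    then obtain c where c: "x = (\<Sum>b\<in>gen T ` I. c b *\<^sub>R b)" "\<forall>b\<in>gen T ` I. 0 \<le> c b"
      unfolding \<delta> by blast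
    have "dual_basis T i x = (if i \<in> I then c (gen T i) else 0)" for i
    proof -
      have "dual_basis T i x = (\<Sum>h\<in>I. c (gen T h) * (if i = h then 1 else 0))"
        by (simp add: c(1) sum.reindex[OF inj] linear_sum[OF dual_basis(1)]
            linear_cmul[OF dual_basis(1)] dual_basis(2))
      also have "\<dots> = (\<Sum>h\<in>I. if i = h then c (gen T h) else 0)"
        by (intro sum.cong) auto
      finally show ?thesis by (simp add: sum.delta')
    qed
    then show "(\<forall>i. 0 \<le> dual_basis T i x) \<and> (\<forall>i. i \<notin> I \<longrightarrow> dual_basis T i x = 0)"
      using c(2) by auto
  }
  {
    assume *: "(\<forall>i. 0 \<le> dual_basis T i x) \<and> (\<forall>i. i \<notin> I \<longrightarrow> dual_basis T i x = 0)"
    define c where "c b = dual_basis T (inv_into UNIV (gen T) b) x" for b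
    have "x = (\<Sum>h\<in>UNIV. dual_basis T h x *\<^sub>R gen T h)" by (rule dual_basis_expand)
    also have "\<dots> = (\<Sum>h\<in>I. dual_basis T h x *\<^sub>R gen T h)"
      using * by (intro sum.mono_neutral_right) auto
    also have "\<dots> = (\<Sum>b\<in>gen T ` I. c b *\<^sub>R b)"
      by (simp add: sum.reindex[OF inj] c_def inv_f_f[OF gen_basis(1)])
    finally show "x \<in> \<delta>"
      unfolding \<delta> using * by (auto simp: c_def intro!: exI[of _ c])
  }
qed

lemma simplicial_cone_ray_index: "simplicial_cone (gen T ` ray_index T) (tcone T)"
proof -
  have u: "I = {i. gen T i \<in> tcone T}" if "simplicial_cone (gen T ` I) (tcone T)" for I
    using simplicial_cone_gen_iff[OF that] by (auto simp: dual_basis(2) split: if_splits)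
  obtain I where I: "simplicial_cone (gen T ` I) (tcone T)"
    using T by (auto simp: cone_fundamental_triple_def)
  show ?thesis
    unfolding ray_index_def by (rule theI[of _ I]) (use I u in blast)+
qed

lemma qlat_closed:
  "0 \<in> qlat T" "x \<in> qlat T \<Longrightarrow> y \<in> qlat T \<Longrightarrow> x + y \<in> qlat T" "x \<in> qlat T \<Longrightarrow> - x \<in> qlat T"
  using T unfolding cone_fundamental_triple_def quasilattice_def
  by (auto intro: int_span_closed)

lemma sum_gen_in_qlat: "(\<Sum>h\<in>UNIV. of_int (k h) *\<^sub>R gen T h) \<in> qlat T"
proof -
  obtain S where S: "qlat T = int_span S" "\<And>i. gen T i \<in> int_span S"
    using T by (auto simp: cone_fundamental_triple_def quasilattice_def)
  show ?thesis unfolding S(1)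
    by (intro int_module.span_sum int_module.span_scale S(2))
qed

lemma dual_basis_sublattice: "l \<in> sublattice T \<Longrightarrow> dual_basis T i l \<in> \<int>"
  unfolding sublattice_def
proof (induction l rule: int_module.span_induct_alt)
  case base then show ?case by (simp add: linear_0[OF dual_basis(1)])
next
  case (step c x y)
  then show ?case
    by (auto simp: linear_add[OF dual_basis(1)] linear_cmul[OF dual_basis(1)] dual_basis(2))
qed

lemma complexify_form_add:
  "complexify_form (dual_basis T i) (u + v) =
     complexify_form (dual_basis T i) u + complexify_form (dual_basis T i) v"
proof -
  have "Re_vec (u + v) = Re_vec u + Re_vec v" "Im_vec (u + v) = Im_vec u + Im_vec v"
    by (simp_all add: Re_vec_def Im_vec_def vec_eq_iff)
  then show ?thesis
    by (simp add: complexify_form_def linear_add[OF dual_basis(1)] complex_eq_iff)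
qed

lemma exp_map_add: "exp_map T (u + v) = exp_map T u * exp_map T v"
  by (simp add: exp_map_def vec_eq_iff complexify_form_add exp_add distrib_left)

lemma complexify_form_of_real:
  "complexify_form (dual_basis T i) (\<chi> i. of_real (v $ i)) = of_real (dual_basis T i v)"
proof -
  have "Re_vec (\<chi> i. of_real (v $ i)) = v" "Im_vec (\<chi> i. of_real (v $ i)) = 0"
    by (simp_all add: Re_vec_def Im_vec_def vec_eq_iff)
  then show ?thesis
    by (simp add: complexify_form_def linear_0[OF dual_basis(1)] complex_of_real_def)
qed

lemma exp_map_sublattice:
  assumes "l \<in> sublattice T"
  shows "exp_map T (\<chi> i. of_real (l $ i)) = 1"
proof -
  have "exp (2 * of_real pi * \<i> * of_real (dual_basis T i l)) = 1" for i
  proof -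
    obtain k where "dual_basis T i l = of_int k"
      using dual_basis_sublattice[OF assms, of i] Ints_cases by blast
    then show ?thesis by (simp add: exp_two_pi_of_int)
  qed
  then show ?thesis by (simp add: exp_map_def complexify_form_of_real vec_eq_iff)
qed

lemma Gamma_act_coset:
  "Gamma_act T (sublattice T #>\<^bsub>qlat_group T\<^esub> v) z = exp_map T (\<chi> i. of_real (v $ i)) * z"
proof -
  have "(\<chi> i. exp (2 * of_real pi * \<i> * of_real (dual_basis T i (l + v))) * z $ i)
      = exp_map T (\<chi> i. of_real (v $ i)) * z" if l: "l \<in> sublattice T" for l
  proof -
    have "(\<chi> i. exp (2 * of_real pi * \<i> * of_real (dual_basis T i (l + v))) * z $ i)
        = exp_map T (\<chi> i. of_real ((l + v) $ i)) * z"
      by (simp only: vec_eq_iff exp_map_def complexify_form_of_real) simp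
    also have "(\<chi> i. complex_of_real ((l + v) $ i)) =
        (\<chi> i. of_real (l $ i)) + (\<chi> i. of_real (v $ i))"
      by (simp add: vec_eq_iff)
    finally show ?thesis by (simp only: exp_map_add exp_map_sublattice[OF l] mult_1_left)
  qed
  moreover have "0 \<in> sublattice T"
    by (simp add: sublattice_def int_span_closed)
  moreover have "sublattice T #>\<^bsub>qlat_group T\<^esub> v = (\<lambda>l. l + v) ` sublattice T"
    by (auto simp: r_coset_def qlat_group_def)
  ultimately have "(\<lambda>v. \<chi> i. exp (2 * of_real pi * \<i> * of_real (dual_basis T i v)) * z $ i) `
      (sublattice T #>\<^bsub>qlat_group T\<^esub> v) = {exp_map T (\<chi> i. of_real (v $ i)) * z}"
    by (auto simp: image_image)
  then show ?thesis by (simp add: Gamma_act_def)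
qed

lemma orbit_rel_iff:
  "(z, w) \<in> orbit_rel T \<longleftrightarrow>
     z \<in> cone_domain T \<and> (\<exists>v\<in>qlat T. w = exp_map T (\<chi> i. of_real (v $ i)) * z)"
proof -
  have "carrier (Gamma_group T) = (\<lambda>v. sublattice T #>\<^bsub>qlat_group T\<^esub> v) ` qlat T"
    by (simp add: Gamma_group_def carrier_FactGroup) (simp add: qlat_group_def)
  then show ?thesis by (auto simp: orbit_rel_def Gamma_act_coset)
qed

lemma exp_map_nonzero: "exp_map T u $ i \<noteq> 0"
  by (simp add: exp_map_def)

lemma exp_map_mult_cone_domain: "exp_map T u * z \<in> cone_domain T \<longleftrightarrow> z \<in> cone_domain T"
  by (simp add: cone_domain_def exp_map_nonzero)

lemma exp_map_zero: "exp_map T 0 = 1"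
  using exp_map_sublattice[of 0] by (simp add: sublattice_def int_span_closed flip: zero_vec_def)

lemma equiv_orbit_rel: "equiv (cone_domain T) (orbit_rel T)"
proof (rule equivI)
  show "orbit_rel T \<subseteq> cone_domain T \<times> cone_domain T"
    by (auto simp: orbit_rel_iff exp_map_mult_cone_domain)
  show "refl_on (cone_domain T) (orbit_rel T)"
    by (auto simp: refl_on_def orbit_rel_iff exp_map_mult_cone_domain exp_map_zero
        simp flip: zero_vec_def intro!: bexI[of _ 0] qlat_closed)
  show "sym (orbit_rel T)"
  proof (rule symI)
    fix z w assume "(z, w) \<in> orbit_rel T"
    then obtain v where v: "z \<in> cone_domain T" "v \<in> qlat T"
        "w = exp_map T (\<chi> i. of_real (v $ i)) * z"
      unfolding orbit_rel_iff by blast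
    have "(\<chi> i. complex_of_real ((- v) $ i)) + (\<chi> i. of_real (v $ i)) = 0"
      by (simp add: vec_eq_iff)
    then have "z = exp_map T (\<chi> i. of_real ((- v) $ i)) * w"
      by (simp only: v(3) exp_map_zero mult_1_left flip: exp_map_add mult.assoc)
    moreover have "w \<in> cone_domain T"
      using v(1) by (simp only: v(3) exp_map_mult_cone_domain)
    ultimately show "(w, z) \<in> orbit_rel T"
      using qlat_closed(3)[OF v(2)] unfolding orbit_rel_iff by blast
  qed
  show "trans (orbit_rel T)"
  proof (rule transI)
    fix x y z assume "(x, y) \<in> orbit_rel T" "(y, z) \<in> orbit_rel T"
    then obtain v w where v: "x \<in> cone_domain T" "v \<in> qlat T" "w \<in> qlat T"
        "y = exp_map T (\<chi> i. of_real (v $ i)) * x" "z = exp_map T (\<chi> i. of_real (w $ i)) * y"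
      unfolding orbit_rel_iff by blast
    have "(\<chi> i. complex_of_real (w $ i)) + (\<chi> i. of_real (v $ i)) = (\<chi> i. of_real ((w + v) $ i))"
      by (simp add: vec_eq_iff)
    then have "z = exp_map T (\<chi> i. of_real ((w + v) $ i)) * x"
      by (simp only: v flip: exp_map_add mult.assoc)
    then show "(x, z) \<in> orbit_rel T"
      using v(1) qlat_closed(2)[OF v(3,2)] unfolding orbit_rel_iff by blast
  qed
qed

lemma quasifold_class_eq_iff:
  assumes "z \<in> cone_domain T" "w \<in> cone_domain T"
  shows "quasifold_class T z = quasifold_class T w \<longleftrightarrow>
    (\<exists>v\<in>qlat T. w = exp_map T (\<chi> i. of_real (v $ i)) * z)"
  using eq_equiv_class_iff[OF equiv_orbit_rel assms] assms
  by (simp add: quasifold_class_def orbit_rel_iff)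

lemma mem_quasifold_class:
  "z \<in> cone_domain T \<Longrightarrow> w \<in> quasifold_class T z \<longleftrightarrow>
    (\<exists>v\<in>qlat T. w = exp_map T (\<chi> i. of_real (v $ i)) * z)"
  by (simp add: quasifold_class_def orbit_rel_iff)

lemma mem_quasitorus_class:
  "w \<in> quasitorus_class T t \<longleftrightarrow> (\<exists>v\<in>qlat T. w = exp_map T (\<chi> i. of_real (v $ i)) * t)"
  by (auto simp: quasitorus_class_def exp_qlat_def r_coset_def complex_torus_def)

lemma quasitorus_act_class:
  assumes z: "z \<in> cone_domain T"
  shows "quasitorus_act T (quasitorus_class T (exp_map T u)) (quasifold_class T z)
    = quasifold_class T (exp_map T u * z)"
proof -
  let ?r = "\<lambda>v::real^'n. \<chi> i. complex_of_real (v $ i)"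
  have "quasifold_class T (t * w) = quasifold_class T (exp_map T u * z)"
    if tw: "t \<in> quasitorus_class T (exp_map T u)" "w \<in> quasifold_class T z" for t w
  proof -
    obtain p q where pq: "p \<in> qlat T" "q \<in> qlat T" "t = exp_map T (?r p) * exp_map T u"
        "w = exp_map T (?r q) * z"
      using tw unfolding mem_quasitorus_class mem_quasifold_class[OF z] by blast
    have "?r (p + q) = ?r p + ?r q" by (simp add: vec_eq_iff)
    then have "t * w = exp_map T (?r (p + q)) * (exp_map T u * z)"
      by (simp only: pq exp_map_add mult_ac)
    moreover have "p + q \<in> qlat T" using pq(1,2) by (rule qlat_closed(2))
    moreover have "exp_map T u * z \<in> cone_domain T" using z by (simp only: exp_map_mult_cone_domain)
    ultimately show ?thesis
      by (metis quasifold_class_eq_iff exp_map_mult_cone_domain)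
  qed
  moreover have "exp_map T u \<in> quasitorus_class T (exp_map T u)" "z \<in> quasifold_class T z"
    using z qlat_closed(1)
    by (auto simp: mem_quasitorus_class mem_quasifold_class exp_map_zero
        simp flip: zero_vec_def intro!: bexI[of _ 0])
  ultimately have "{quasifold_class T (exp_map T v * w) | v w.
      exp_map T v \<in> quasitorus_class T (exp_map T u) \<and> w \<in> quasifold_class T z}
    = {quasifold_class T (exp_map T u * z)}" by blast
  then show ?thesis by (simp add: quasitorus_act_def)
qed

end

lemma complexify_linear:
  assumes "linear f"
  shows "Vector_Spaces.linear (*s) (*s) (complexify f)"
proof -
  have R: "Re_vec (u + v) = Re_vec u + Re_vec v" "Im_vec (u + v) = Im_vec u + Im_vec v"
    "Re_vec (c *s u) = Re c *\<^sub>R Re_vec u - Im c *\<^sub>R Im_vec u"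
    "Im_vec (c *s u) = Re c *\<^sub>R Im_vec u + Im c *\<^sub>R Re_vec u" for u v :: "complex ^ 'a" and c
    by (simp_all add: Re_vec_def Im_vec_def vec_eq_iff)
  show ?thesis
    by unfold_locales
      (auto simp: complexify_def vec_eq_iff R linear_add[OF assms] linear_diff[OF assms]
        linear_cmul[OF assms] complex_eq_iff algebra_simps)
qed

lemma complexify_of_real:
  assumes "linear f"
  shows "complexify f (\<chi> i. of_real (v $ i)) = (\<chi> i. of_real (f v $ i))"
proof -
  have "Re_vec (\<chi> i. of_real (v $ i)) = v" "Im_vec (\<chi> i. of_real (v $ i)) = 0"
    by (simp_all add: Re_vec_def Im_vec_def vec_eq_iff)
  then show ?thesis
    by (simp add: complexify_def linear_0[OF assms] complex_of_real_def)
qed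

context
  fixes T1 :: "('n::finite) cone_triple" and T2 :: "('m::finite) cone_triple"
    and f :: "real ^ 'n \<Rightarrow> real ^ 'm"
  assumes T1: "cone_fundamental_triple T1" and T2: "cone_fundamental_triple T2"
    and f: "cone_morphism T1 T2 f"
begin

lemma f_linear: "linear f"
  using f by (simp add: cone_morphism_def)

lemma exponent:
  assumes "h \<in> ray_index T1"
  shows "0 \<le> dual_basis T2 i (f (gen T1 h))"
    and "i \<notin> ray_index T2 \<Longrightarrow> dual_basis T2 i (f (gen T1 h)) = 0"
proof -
  have "gen T1 h \<in> tcone T1"
    using assms by (auto simp: simplicial_cone_gen_iff[OF T1 simplicial_cone_ray_index[OF T1]]
        dual_basis(2)[OF T1])
  then have "f (gen T1 h) \<in> tcone T2"
    using f by (auto simp: cone_morphism_def)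
  then show "0 \<le> dual_basis T2 i (f (gen T1 h))"
    "i \<notin> ray_index T2 \<Longrightarrow> dual_basis T2 i (f (gen T1 h)) = 0"
    by (auto simp: simplicial_cone_gen_iff[OF T2 simplicial_cone_ray_index[OF T2]])
qed

lemma toric_monomials_cone_domain:
  assumes "z \<in> cone_domain T1"
  shows "toric_monomials T1 T2 f z x \<in> cone_domain T2"
  using assms exponent(2)
  by (fastforce simp: cone_domain_def toric_monomials_def chosen_power_def)

lemma dual_basis_f_expand:
  "dual_basis T2 i (f v) = (\<Sum>h\<in>UNIV. dual_basis T1 h v * dual_basis T2 i (f (gen T1 h)))"
  by (subst dual_basis_expand[OF T1, of v])
    (simp add: linear_sum[OF f_linear] linear_cmul[OF f_linear]
      linear_sum[OF dual_basis(1)[OF T2]] linear_cmul[OF dual_basis(1)[OF T2]])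

text \<open>Shifting the logarithms by the coordinates of \<open>u\<close> multiplies the monomials by
  $\exp_{\delta_2}(f(u))$.\<close>

lemma toric_monomials_shift:
  "toric_monomials T1 T2 f (exp_map T1 u * z)
     (\<lambda>h. x h + complexify_form (dual_basis T1 h) u) =
   exp_map T2 (complexify f u) * toric_monomials T1 T2 f z x"
proof -
  let ?a = "\<lambda>i h. dual_basis T2 i (f (gen T1 h))"
  let ?b = "\<lambda>h. complexify_form (dual_basis T1 h) u"
  have R: "Re_vec (complexify f u) = f (Re_vec u)" "Im_vec (complexify f u) = f (Im_vec u)"
    by (simp_all add: Re_vec_def Im_vec_def complexify_def vec_eq_iff)
  have "complexify_form (dual_basis T2 i) (complexify f u) = (\<Sum>h\<in>UNIV. ?a i h * ?b h)" for i
    by (simp add: complexify_form_def R dual_basis_f_expand[of _ "Re_vec u"]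
        dual_basis_f_expand[of _ "Im_vec u"] complex_eq_iff mult_ac)
  then have e: "exp_map T2 (complexify f u) $ i =
      (\<Prod>h\<in>UNIV. exp (2 * of_real pi * \<i> * of_real (?a i h) * ?b h))" for i
    by (simp add: exp_map_def sum_distrib_left exp_sum mult_ac)
  have "chosen_power ((exp_map T1 u * z) $ h) (x h + ?b h) (?a i h) =
     (if z $ h = 0 then 1 else exp (2 * of_real pi * \<i> * of_real (?a i h) * ?b h)) *
     chosen_power (z $ h) (x h) (?a i h)" for i h
    by (simp add: chosen_power_def exp_map_nonzero[OF T1] exp_add distrib_left)
  then have "chosen_power ((exp_map T1 u * z) $ h) (x h + ?b h) (?a i h) =
     exp (2 * of_real pi * \<i> * of_real (?a i h) * ?b h) *
     chosen_power (z $ h) (x h) (?a i h)" for i h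
    by (auto simp: chosen_power_def)
  then show ?thesis
    by (simp add: toric_monomials_def vec_eq_iff e prod.distrib)
qed

lemma log_choice_exists: "\<exists>x. log_choice z x"
proof -
  have "w = exp (2 * of_real pi * \<i> * (Ln w / (2 * of_real pi * \<i>)))" if "w \<noteq> 0" for w
    using that by simp
  then show ?thesis
    unfolding log_choice_def by (intro exI[of _ "\<lambda>h. Ln (z $ h) / (2 * of_real pi * \<i>)"]) blast
qed

lemma toric_monomials_log_choice:
  assumes x: "log_choice z x" and y: "log_choice z y"
  shows "\<exists>v\<in>qlat T2. toric_monomials T1 T2 f z y =
    exp_map T2 (\<chi> i. of_real (v $ i)) * toric_monomials T1 T2 f z x"
proof -
  have "\<exists>k::int. z $ h \<noteq> 0 \<longrightarrow> y h = x h + of_int k" for h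
  proof (cases "z $ h = 0")
    case False
    with x y have "exp (2 * of_real pi * \<i> * y h) = exp (2 * of_real pi * \<i> * x h)"
      by (simp add: log_choice_def)
    then obtain k :: int where
      "2 * of_real pi * \<i> * y h = 2 * of_real pi * \<i> * x h + of_int (2 * k) * (of_real pi * \<i>)"
      by (auto simp: exp_eq)
    then have "(2 * of_real pi * \<i>) * y h = (2 * of_real pi * \<i>) * (x h + of_int k)"
      by (simp add: algebra_simps)
    then have "y h = x h + of_int k" by simp
    then show ?thesis by blast
  qed auto
  then obtain k :: "'n \<Rightarrow> int" where k: "\<And>h. z $ h \<noteq> 0 \<Longrightarrow> y h = x h + of_int (k h)"
    by metis
  define q where "q = (\<Sum>h\<in>UNIV. of_int (k h) *\<^sub>R gen T1 h)"
  let ?r = "\<chi> i. complex_of_real (q $ i)"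
  have q: "q \<in> qlat T1"
    unfolding q_def by (rule sum_gen_in_qlat[OF T1])
  have d: "dual_basis T1 h q = of_int (k h)" for h
    by (simp add: q_def linear_sum[OF dual_basis(1)[OF T1]] linear_cmul[OF dual_basis(1)[OF T1]]
        dual_basis(2)[OF T1] if_distrib cong: if_cong)
  have "exp_map T1 ?r = 1"
    by (simp add: exp_map_def vec_eq_iff complexify_form_of_real[OF T1] d exp_two_pi_of_int)
  then have "exp_map T2 (complexify f ?r) * toric_monomials T1 T2 f z x =
      toric_monomials T1 T2 f z (\<lambda>h. x h + of_int (k h))"
    using toric_monomials_shift[of ?r z x] by (simp add: complexify_form_of_real[OF T1] d)
  also have "\<dots> = toric_monomials T1 T2 f z y"
    using k by (auto simp: toric_monomials_def vec_eq_iff chosen_power_def intro!: prod.cong)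
  finally have "toric_monomials T1 T2 f z y =
      exp_map T2 (\<chi> i. of_real (f q $ i)) * toric_monomials T1 T2 f z x"
    by (simp add: complexify_of_real[OF f_linear])
  moreover have "f q \<in> qlat T2"
    using f q by (auto simp: cone_morphism_def)
  ultimately show ?thesis by blast
qed

lemma log_choice_shift:
  "log_choice z x \<Longrightarrow>
    log_choice (exp_map T1 u * z) (\<lambda>h. x h + complexify_form (dual_basis T1 h) u)"
  by (auto simp: log_choice_def exp_map_def exp_add distrib_left mult_ac)

lemma affine_toric_morphism_class:
  assumes z: "z \<in> cone_domain T1" and x: "log_choice z x"
  shows "affine_toric_morphism T1 T2 f (quasifold_class T1 z) =
    quasifold_class T2 (toric_monomials T1 T2 f z x)"
proof -
  have "quasifold_class T2 (toric_monomials T1 T2 f w y) =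
      quasifold_class T2 (toric_monomials T1 T2 f z x)"
    if w: "w \<in> quasifold_class T1 z" and y: "log_choice w y" for w y
  proof -
    obtain v where v: "v \<in> qlat T1" "w = exp_map T1 (\<chi> i. of_real (v $ i)) * z"
      using w z by (auto simp: mem_quasifold_class[OF T1])
    let ?r = "\<chi> i. complex_of_real (v $ i)"
    let ?x = "\<lambda>h. x h + complexify_form (dual_basis T1 h) ?r"
    have wd: "w \<in> cone_domain T1"
      using z by (simp add: v exp_map_mult_cone_domain[OF T1])
    have "log_choice w ?x"
      unfolding v(2) by (rule log_choice_shift[OF x])
    from toric_monomials_log_choice[OF this y]
    have "quasifold_class T2 (toric_monomials T1 T2 f w y) =
        quasifold_class T2 (toric_monomials T1 T2 f w ?x)"
      by (metis quasifold_class_eq_iff[OF T2] toric_monomials_cone_domain wd)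
    also have "toric_monomials T1 T2 f w ?x =
        exp_map T2 (\<chi> i. of_real (f v $ i)) * toric_monomials T1 T2 f z x"
      unfolding v(2) toric_monomials_shift by (simp add: complexify_of_real[OF f_linear])
    also have "quasifold_class T2 \<dots> = quasifold_class T2 (toric_monomials T1 T2 f z x)"
    proof (rule sym, subst quasifold_class_eq_iff[OF T2])
      show "\<exists>q\<in>qlat T2. exp_map T2 (\<chi> i. of_real (f v $ i)) * toric_monomials T1 T2 f z x =
          exp_map T2 (\<chi> i. of_real (q $ i)) * toric_monomials T1 T2 f z x"
        using v(1) f by (intro bexI[of _ "f v"]) (auto simp: cone_morphism_def)
    qed (use z in \<open>simp_all add: exp_map_mult_cone_domain[OF T2] toric_monomials_cone_domain\<close>)
    finally show ?thesis .
  qed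
  moreover have "z \<in> quasifold_class T1 z"
    using equiv_class_self[OF equiv_orbit_rel[OF T1] z] by (simp add: quasifold_class_def)
  ultimately have "{quasifold_class T2 (toric_monomials T1 T2 f w y) | w y.
      w \<in> quasifold_class T1 z \<and> log_choice w y} =
    {quasifold_class T2 (toric_monomials T1 T2 f z x)}"
    using x by blast
  then show ?thesis by (simp add: affine_toric_morphism_def)
qed

lemma affine_toric_morphism_in_quasifold:
  assumes "p \<in> quasifold T1"
  shows "affine_toric_morphism T1 T2 f p \<in> quasifold T2"
proof -
  obtain z where z: "z \<in> cone_domain T1" "p = quasifold_class T1 z"
    using assms by (auto simp: quasifold_def quasifold_class_def elim: quotientE)
  obtain x where x: "log_choice z x"
    using log_choice_exists by blast
  show ?thesis
    unfolding z(2) affine_toric_morphism_class[OF z(1) x]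
    using toric_monomials_cone_domain[OF z(1)]
    by (simp add: quasifold_def quasifold_class_def quotientI)
qed

end

end

theory Submission
  imports Defs
begin

text \<open>In logarithmic coordinates the action of \<open>exp_map T1 v\<close> is the translation
  of \<open>x h\<close> by the h-th dual coordinate of v, and each monomial is an exponential of a
  linear form in the \<open>x h\<close>. Expanding v in the basis \<open>gen T1\<close>, the
  translation contributes exactly the i-th dual coordinate of f(v) to the exponent of the i-th
  monomial. At a zero coordinate both sides carry the same factor 0 or 1. This is
  \<open>toric_monomials_shift\<close>; \<open>quasitorus_act_class\<close> and
  \<open>affine_toric_morphism_class\<close> reduce the claim to it.\<close>

theorem proposition3p11:
  fixes T1 :: "('n::finite) cone_triple" and T2 :: "('m::finite) cone_triple"
    and f :: "real ^ 'n \<Rightarrow> real ^ 'm"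
  assumes "cone_fundamental_triple T1" and "cone_fundamental_triple T2"
    and "cone_morphism T1 T2 f"
  shows "\<forall>v :: complex ^ 'n. \<forall>z \<in> cone_domain T1.
    affine_toric_morphism T1 T2 f
      (quasitorus_act T1 (quasitorus_class T1 (exp_map T1 v)) (quasifold_class T1 z)) =
    quasitorus_act T2 (quasitorus_class T2 (exp_map T2 (complexify f v)))
      (affine_toric_morphism T1 T2 f (quasifold_class T1 z))"
proof (intro allI ballI)
  fix v :: "complex ^ 'n" and z assume z: "z \<in> cone_domain T1"
  obtain x where x: "log_choice z x"
    using log_choice_exists[OF assms] by blast
  \<comment> \<open>The morphism may be computed with any logarithms of the moved point; the
    translated ones make the monomials comparable with those of \<open>z\<close>.\<close>
  let ?x = "\<lambda>h. x h + complexify_form (dual_basis T1 h) v"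
  have "exp_map T1 v * z \<in> cone_domain T1"
    using z by (simp only: exp_map_mult_cone_domain[OF assms(1)])
  then have "affine_toric_morphism T1 T2 f
      (quasitorus_act T1 (quasitorus_class T1 (exp_map T1 v)) (quasifold_class T1 z)) =
    quasifold_class T2 (toric_monomials T1 T2 f (exp_map T1 v * z) ?x)"
    by (simp only: quasitorus_act_class[OF assms(1) z]
        affine_toric_morphism_class[OF assms _ log_choice_shift[OF assms x]])
  \<comment> \<open>Here the representatives themselves agree, not only their classes.\<close>
  also have "\<dots> =
    quasifold_class T2 (exp_map T2 (complexify f v) * toric_monomials T1 T2 f z x)"
    by (simp only: toric_monomials_shift[OF assms])
  \<comment> \<open>The monomial vector lies in \<open>cone_domain T2\<close>, so the action on its
    class can be read off from this representative.\<close>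
  also have "\<dots> = quasitorus_act T2 (quasitorus_class T2 (exp_map T2 (complexify f v)))
      (affine_toric_morphism T1 T2 f (quasifold_class T1 z))"
    by (simp only: affine_toric_morphism_class[OF assms z x]
        quasitorus_act_class[OF assms(2) toric_monomials_cone_domain[OF assms z]])
  finally show "affine_toric_morphism T1 T2 f
      (quasitorus_act T1 (quasitorus_class T1 (exp_map T1 v)) (quasifold_class T1 z)) =
    quasitorus_act T2 (quasitorus_class T2 (exp_map T2 (complexify f v)))
      (affine_toric_morphism T1 T2 f (quasifold_class T1 z))" .
qed

end
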